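(* Let $A=(A(n))_{n\in\mathbb{N}}\in\mathcal{L}^{\mathrm{Lya}}(\mathbb{N},\mathbb{R}^{d\times d})$, $\varepsilon>0$, $k,m\in\mathbb{N}$ with $m>k$, and $x_0\in\mathbb{R}^d\setminus\{0\}$. Let $(x(n,x_0))_{n\in\mathbb{N}}$ be the solution of $x(n+1)=A(n)x(n)$ with $x(0,x_0)=x_0$. Then: (a) (Forward Millionshikov Rotation Method) If $k\geq 1$, there exists a sequence $(Q(n))_{n\in\mathbb{N}}$ in $\mathbb{R}^{d\times d}$ such that $Q(n)=0$ for $n\ne k-1$, $\|Q(k-1)\|\le\varepsilon\|A(k-1)\|$, $(A(n)+Q(n))_{n\in\mathbb{N}}\in\mathcal{L}^{\mathrm{Lya}}(\mathbb{N},\mathbb{R}^{d\times d})$, and such that the solution $(z(n))_{n\in\mathbb{N}}$ of the perturbed system $z(n+1)=(A(n)+Q(n))z(n)$ with $z(k-1)=x(k-1,x_0)$ satisfies $$\|z(m)\|\ge\frac{\sin\varepsilon}{2}\,\|\Phi_A(m,k)\|\,\|z(k)\|\qquad\text{and}\qquad \|x(k,x_0)\|=\|z(k)\|.$$ (b) (Backward Millionshikov Rotation Method) There exists a sequence $(Q(n))_{n\in\mathbb{N}}$ in $\mathbb{R}^{d\times d}$ such that $Q(n)=0$ for $n\ne m$, $\|Q(m)\|\le\varepsilon\|A(m)\|$, $(A(n)+Q(n))_{n\in\mathbb{N}}\in\mathcal{L}^{\mathrm{Lya}}(\mathbb{N},\mathbb{R}^{d\times d})$, and such that the solution $(z(n))_{n\in\mathbb{N}}$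 of the perturbed system $z(n+1)=(A(n)+Q(n))z(n)$ with $z(m+1)=x(m+1,x_0)$ satisfies $$\|z(k)\|\ge\frac{\sin\varepsilon}{2}\,\|\Phi_A(k,m)\|\,\|z(m)\|\qquad\text{and}\qquad \|x(m,x_0)\|=\|z(m)\|.$$
   Context: $\mathbb{N}=\{0,1,2,\dots\}$. $\|\cdot\|$ is the Euclidean norm on $\mathbb{R}^d$ and the induced operator norm on $\mathbb{R}^{d\times d}$. $\mathcal{L}^{\mathrm{Lya}}(\mathbb{N},\mathbb{R}^{d\times d})$ is the set of sequences $B=(B(n))_{n\in\mathbb{N}}$ of invertible matrices such that both $B$ and $(B(n)^{-1})_{n}$ are bounded. The transition matrix is $\Phi_A(n,m)=A(n-1)\cdots A(m)$ for $n>m$, $\Phi_A(n,n)=I$, and $\Phi_A(n,m)=\Phi_A(m,n)^{-1}$ for $n<m$. *)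

theory Defs
  imports "HOL-Analysis.Analysis"
begin

text \<open>The norm that the library puts on \<^typ>\<open>real^'d^'d\<close> is the Frobenius norm. The matrix norm
  meant here is the operator norm induced by the Euclidean norm on \<^typ>\<open>real^'d\<close>.\<close>

definition opnorm :: "real^'d^'d \<Rightarrow> real" where
  "opnorm M = onorm (\<lambda>v. M *v v)"

definition bounded_seq :: "(nat \<Rightarrow> real^'d^'d) \<Rightarrow> bool" where
  "bounded_seq B \<longleftrightarrow> (\<exists>K. \<forall>n. opnorm (B n) \<le> K)"

definition Lya :: "(nat \<Rightarrow> real^'d^'d) set" where
  "Lya = {B. (\<forall>n. invertible (B n)) \<and> bounded_seq B \<and> bounded_seq (\<lambda>n. matrix_inv (B n))}"

text \<open>\<open>forward_prod A m j\<close> is the product \<open>A (m + j - 1) ** \<dots> ** A m\<close> of \<open>j\<close> factors.\<close>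

primrec forward_prod :: "(nat \<Rightarrow> real^'d^'d) \<Rightarrow> nat \<Rightarrow> nat \<Rightarrow> real^'d^'d" where
  "forward_prod A m 0 = mat 1"
| "forward_prod A m (Suc j) = A (m + j) ** forward_prod A m j"

definition transition :: "(nat \<Rightarrow> real^'d^'d) \<Rightarrow> nat \<Rightarrow> nat \<Rightarrow> real^'d^'d" where
  "transition A n m =
    (if m \<le> n then forward_prod A m (n - m) else matrix_inv (forward_prod A n (m - n)))"

text \<open>The initial time \<open>j\<close> may be positive; the recursion is still required at all times in
  \<open>\<nat>\<close>, including those before \<open>j\<close>.\<close>

definition solves_ivp ::
  "(nat \<Rightarrow> real^'d^'d) \<Rightarrow> nat \<Rightarrow> real^'d \<Rightarrow> (nat \<Rightarrow> real^'d) \<Rightarrow> bool" where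
  "solves_ivp A j \<xi> z \<longleftrightarrow> (\<forall>n. z (n + 1) = A n *v z n) \<and> z j = \<xi>"

end

theory Submission
  imports Defs
begin

text \<open>Let \<open>u\<close> be a unit vector, \<open>T\<close> a matrix and \<open>s = sin \<epsilon> > 0\<close>. If \<open>\<parallel>T w\<parallel> < s/2 \<parallel>T\<parallel>\<close> held for
  \<open>w = u\<close> and for the two vectors obtained by turning \<open>u\<close> through an angle with sine \<open>3s/5\<close> towards
  \<open>e\<close> and \<open>-e\<close>, for each unit \<open>e\<close> orthogonal to \<open>u\<close>, then \<open>\<parallel>T e\<parallel> \<le> 5/6 \<parallel>T\<parallel>\<close>, and Cauchy-Schwarz would
  make \<open>T\<close> strictly smaller than its own norm. So some unit \<open>w\<close> close to \<open>u\<close> is stretched enough.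
  Instead of a rotation, the rank-one update \<open>I + (w - u) u\<^sup>T\<close> moves \<open>u\<close> to \<open>w\<close>; it is invertible
  because the angle between \<open>u\<close> and \<open>w\<close> is acute. Composing it with \<open>A (k - 1)\<close> on the left gives the
  forward perturbation, and composing its analogue \<open>w \<mapsto> u\<close> with \<open>A m\<close> on the right the backward one.\<close>

section \<open>Operator norm and rank-one perturbations of the identity\<close>

lemma opnorm_nonneg: "0 \<le> opnorm M"
  unfolding opnorm_def by (rule onorm_pos_le) (rule matrix_vector_mul_bounded_linear)

lemma opnorm_le: "(\<And>v. norm (M *v v) \<le> c * norm v) \<Longrightarrow> opnorm M \<le> c"
  unfolding opnorm_def by (rule onorm_le)

lemma opnorm_mult: "opnorm (M ** N) \<le> opnorm M * opnorm N"
  unfolding opnorm_def matrix_vector_mul_assoc[symmetric]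
  using onorm_compose[OF matrix_vector_mul_bounded_linear[of M] matrix_vector_mul_bounded_linear[of N]]
  by (simp add: o_def)

text \<open>Pairing a kernel vector \<open>v\<close> with \<open>u\<close> gives
  \<open>(u \<bullet> v) * (u \<bullet> w) = 0\<close>, hence \<open>u \<bullet> v = 0\<close>; the
  update then fixes \<open>v\<close>, so \<open>v = 0\<close>. The norm bound is Cauchy-Schwarz for
  the unit vector \<open>u\<close>.\<close>

lemma rank_one_update:
  fixes u w :: "real^'d"
  assumes u: "norm u = 1" and uw: "u \<bullet> w \<noteq> 0"
  obtains S :: "real^'d^'d"
  where "opnorm S \<le> norm (w - u)" "invertible (mat 1 + S)" "(mat 1 + S) *v u = w"
proof
  define S where "S = matrix (\<lambda>v. (u \<bullet> v) *\<^sub>R (w - u))"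
  have lin: "linear (\<lambda>v. (u \<bullet> v) *\<^sub>R (w - u))"
    by (rule linearI) (simp_all add: inner_add_right algebra_simps)
  have S: "S *v v = (u \<bullet> v) *\<^sub>R (w - u)" for v
    unfolding S_def using fun_cong[OF matrix_vector_mul(2)[OF lin], of v] by simp
  have uu: "u \<bullet> u = 1" using u by (simp add: norm_eq_1)
  show "opnorm S \<le> norm (w - u)"
    using Cauchy_Schwarz_ineq2[of u] u
    by (intro opnorm_le) (simp add: S mult.commute[of "norm (w - u)"] mult_right_mono)
  show "(mat 1 + S) *v u = w"
    by (simp add: S uu matrix_vector_mult_add_rdistrib)
  have "v = 0" if "(mat 1 + S) *v v = 0" for v
  proof -
    have v: "v + (u \<bullet> v) *\<^sub>R (w - u) = 0"
      using that by (simp add: S matrix_vector_mult_add_rdistrib)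
    then have "u \<bullet> (v + (u \<bullet> v) *\<^sub>R (w - u)) = 0" by simp
    then have "(u \<bullet> v) * (u \<bullet> w) = 0"
      by (simp add: inner_add_right inner_diff_right uu algebra_simps)
    with v uw show "v = 0" by simp
  qed
  then show "invertible (mat 1 + S)"
    by (simp add: invertible_left_inverse matrix_left_invertible_ker)
qed

section \<open>A nearby direction that is stretched enough\<close>

lemma stretched_direction:
  fixes u :: "real^'d" and T :: "real^'d^'d"
  assumes u: "norm u = 1" and eps: "\<epsilon> > 0"
  obtains w where "norm w = 1" "norm (w - u) \<le> \<epsilon>" "u \<bullet> w > 0"
    "sin \<epsilon> / 2 * opnorm T \<le> norm (T *v w)"
proof (cases "sin \<epsilon> > 0 \<and> opnorm T > 0")
  \<comment> \<open>The lower bound is nonpositive here, for instance when a large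
    \<open>\<epsilon>\<close> makes the sine negative, so \<open>w = u\<close> serves.\<close>
  case False
  have "sin \<epsilon> / 2 * opnorm T \<le> 0"
    using False opnorm_nonneg[of T] by (auto simp: not_less mult_le_0_iff)
  then have "sin \<epsilon> / 2 * opnorm T \<le> norm (T *v u)"
    using norm_ge_zero[of "T *v u"] by linarith
  moreover have "u \<bullet> u > 0" using u by (simp add: norm_eq_1)
  ultimately show ?thesis using that[of u] u eps by simp
next
  case True
  \<comment> \<open>The factor 3/5 keeps \<open>c \<ge> 4/5\<close>, so \<open>w\<close> stays close
    to \<open>u\<close>, and makes \<open>1 / (2 * \<sigma>)\<close> equal to 5/6 of
    \<open>1 / s\<close>, small enough for the contradiction.\<close>
  define t s \<sigma> c where "t = opnorm T" and "s = sin \<epsilon>" and "\<sigma> = 3/5 * s" and "c = sqrt (1 - \<sigma>\<^sup>2)"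
  have s: "0 < s" "s \<le> 1" "s \<le> \<epsilon>" and t: "t > 0"
    using True eps sin_x_le_x[of \<epsilon>] by (auto simp: s_def t_def)
  have uu: "u \<bullet> u = 1" using u by (simp add: norm_eq_1)
  have s2: "s\<^sup>2 \<le> 1" using s by (simp add: power_le_one)
  have \<sigma>2: "\<sigma>\<^sup>2 = 9/25 * s\<^sup>2" by (simp add: \<sigma>_def power_mult_distrib power_divide)
  have c2: "c\<^sup>2 = 1 - \<sigma>\<^sup>2" using s2 by (simp add: c_def \<sigma>2)
  have c: "c \<ge> 4/5"
    unfolding c_def by (rule real_le_rsqrt) (use s2 in \<open>simp add: \<sigma>2 power_divide\<close>)
  \<comment> \<open>The left side is the squared chord from \<open>u\<close> to the turned vector.
    It is controlled through \<open>(1 + c) * (1 - c) = \<sigma>\<^sup>2\<close> and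
    \<open>1 + c \<ge> 9/5\<close>.\<close>
  have chord: "2 - 2 * c \<le> \<epsilon>\<^sup>2"
  proof -
    have "(9/5) * (1 - c) \<le> (1 + c) * (1 - c)"
      using c c2 by (intro mult_right_mono) (auto simp: c_def \<sigma>2)
    also have "\<dots> = 9/25 * s\<^sup>2" using c2 \<sigma>2 by (simp add: algebra_simps power2_eq_square)
    finally have "2 - 2 * c \<le> s\<^sup>2" by (simp add: field_simps) (smt (verit) zero_le_power2)
    also have "\<dots> \<le> \<epsilon>\<^sup>2" using s by (simp add: power_mono)
    finally show ?thesis .
  qed
  have near: "norm w = 1 \<and> norm (w - u) \<le> \<epsilon> \<and> u \<bullet> w > 0"
    if w: "w = c *\<^sub>R u + r *\<^sub>R e" and e: "norm e = 1" "u \<bullet> e = 0" and r: "r\<^sup>2 = \<sigma>\<^sup>2" for w e r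
  proof -
    have ee: "e \<bullet> e = 1" using e by (simp add: norm_eq_1)
    have uw: "u \<bullet> w = c" by (simp add: w inner_add_right uu e)
    have ww: "w \<bullet> w = 1"
      using c2 r by (simp add: w inner_add_right inner_add_left uu ee e inner_commute[of e u] power2_eq_square)
    have "(norm (w - u))\<^sup>2 = 2 - 2 * c"
      by (simp add: power2_norm_eq_inner inner_diff_left inner_diff_right ww uu uw inner_commute[of w u])
    then have "norm (w - u) \<le> \<epsilon>" using chord eps by (auto intro: power2_le_imp_le)
    then show ?thesis using ww uw c by (simp add: norm_eq_1)
  qed
  note found = that
  show ?thesis
  proof (rule ccontr)
    assume no: "\<not> thesis"
    have small: "norm (T *v w) < s / 2 * t" if "norm w = 1" "norm (w - u) \<le> \<epsilon>" "u \<bullet> w > 0" for w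
      using no found[OF that] by (auto simp: s_def t_def not_le[symmetric])
    have Tu: "norm (T *v u) \<le> 1/2 * t"
    proof -
      have "norm (T *v u) < s / 2 * t" using small[of u] u uu eps by simp
      also have "\<dots> \<le> 1/2 * t" using s t by (intro mult_right_mono) auto
      finally show ?thesis by simp
    qed
    have Te: "norm (T *v e) \<le> 5/6 * t" if e: "norm e = 1" "u \<bullet> e = 0" for e
    proof -
      let ?p = "c *\<^sub>R u + \<sigma> *\<^sub>R e" and ?q = "c *\<^sub>R u + (- \<sigma>) *\<^sub>R e"
      have "norm (T *v ?p) < s / 2 * t" "norm (T *v ?q) < s / 2 * t"
        using near[OF refl e, of \<sigma>] near[OF refl e, of "- \<sigma>"] small[of ?p] small[of ?q] by simp_all
      \<comment> \<open>Subtracting the images of the two turned vectors cancels the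
        \<open>u\<close> component and isolates \<open>T *v e\<close>.\<close>
      moreover have "T *v ?p - T *v ?q = (2 * \<sigma>) *\<^sub>R (T *v e)"
        by (simp add: matrix_vector_right_distrib matrix_vector_mult_diff_distrib matrix_vector_mult_scaleR
            flip: scaleR_add_left)
      ultimately have "norm ((2 * \<sigma>) *\<^sub>R (T *v e)) < s * t"
        using norm_triangle_ineq4[of "T *v ?p" "T *v ?q"] by simp
      then have "s * (6/5 * norm (T *v e)) < s * t" using s by (simp add: \<sigma>_def)
      then show ?thesis using s by simp
    qed
    have Tp: "norm (T *v p) \<le> 5/6 * t * norm p" if "u \<bullet> p = 0" for p
    proof (cases "p = 0")
      case False
      then have "norm (T *v (inverse (norm p) *\<^sub>R p)) \<le> 5/6 * t" by (intro Te) (auto simp: that)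
      then show ?thesis using False by (simp add: matrix_vector_mult_scaleR field_simps)
    qed simp
    have "norm (T *v v) \<le> (sqrt (34/36) * t) * norm v" for v
    proof -
      define a p where "a = u \<bullet> v" and "p = v - a *\<^sub>R u"
      have up: "u \<bullet> p = 0" by (simp add: p_def a_def inner_diff_right uu)
      have v: "v = a *\<^sub>R u + p" by (simp add: p_def)
      have nv: "(norm v)\<^sup>2 = \<bar>a\<bar>\<^sup>2 + (norm p)\<^sup>2"
        unfolding power2_norm_eq_inner
        by (subst (1 2) v) (simp add: inner_add_right inner_add_left uu up
            inner_commute[of p u] power2_eq_square)
      have "T *v v = a *\<^sub>R (T *v u) + T *v p"
        by (subst v) (simp add: matrix_vector_right_distrib matrix_vector_mult_scaleR)
      then have "norm (T *v v) \<le> \<bar>a\<bar> * norm (T *v u) + norm (T *v p)"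
        using norm_triangle_ineq[of "a *\<^sub>R (T *v u)" "T *v p"] by simp
      also have "\<dots> \<le> \<bar>a\<bar> * (1/2 * t) + 5/6 * t * norm p"
        using Tu Tp[OF up] by (intro add_mono mult_left_mono) auto
      also have "\<dots> = (1/2 * \<bar>a\<bar> + 5/6 * norm p) * t" by (simp add: algebra_simps)
      \<comment> \<open>Cauchy-Schwarz in the plane: (1/2, 5/6) has squared length 34/36 < 1. The
        gap between the squared sides is the square shown nonnegative below.\<close>
      also have "1/2 * \<bar>a\<bar> + 5/6 * norm p \<le> sqrt (34/36) * norm v"
      proof (rule power2_le_imp_le)
        have "0 \<le> (5/6 * \<bar>a\<bar> - 1/2 * norm p)\<^sup>2" by simp
        then show "(1/2 * \<bar>a\<bar> + 5/6 * norm p)\<^sup>2 \<le> (sqrt (34/36) * norm v)\<^sup>2"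
          unfolding power_mult_distrib nv by (simp add: power2_eq_square algebra_simps)
      qed simp
      finally show ?thesis using t by (simp add: mult_right_mono algebra_simps)
    qed
    then have "t \<le> sqrt (34/36) * t" unfolding t_def by (rule opnorm_le)
    moreover have "sqrt (34/36) * t < 1 * t"
      using t by (intro mult_strict_right_mono) (simp_all add: real_sqrt_lt_1_iff del: real_sqrt_divide)
    ultimately show False by simp
  qed
qed

section \<open>Transition products and solutions\<close>

lemma invertible_forward_prod:
  assumes "\<And>n. invertible (B n)"
  shows "invertible (forward_prod B i j)"
proof (induction j)
  case 0
  show ?case by (auto simp: invertible_def intro: exI[of _ "mat 1"])
qed (simp add: assms invertible_mult)

text \<open>The recursion is assumed only on the window from \<open>i\<close> to
  \<open>i + j - 1\<close>, so that a perturbed solution can be propagated by the unperturbed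
  product wherever the perturbation vanishes.\<close>

lemma forward_prod_solution:
  assumes "\<And>n. i \<le> n \<Longrightarrow> n < i + j \<Longrightarrow> z (n + 1) = B n *v z n"
  shows "z (i + j) = forward_prod B i j *v z i"
  using assms
proof (induction j)
  case (Suc j)
  have "z (i + Suc j) = B (i + j) *v z (i + j)"
    using Suc.prems[of "i + j"] by simp
  also have "z (i + j) = forward_prod B i j *v z i"
    by (intro Suc.IH Suc.prems) simp_all
  finally show ?case by (simp add: matrix_vector_mul_assoc)
qed simp

lemma matrix_inv_cancel:
  fixes M :: "real^'d^'d"
  assumes "invertible M"
  shows "matrix_inv M *v (M *v v) = v" "M *v (matrix_inv M *v v) = v"
proof -
  have "M ** matrix_inv M = mat 1 \<and> matrix_inv M ** M = mat 1"
    using assms unfolding invertible_def matrix_inv_def by (rule someI_ex)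
  then show "matrix_inv M *v (M *v v) = v" "M *v (matrix_inv M *v v) = v"
    by (simp_all add: matrix_vector_mul_assoc)
qed

text \<open>Invertibility lets the value at time \<open>j\<close> be pulled back to time 0, from
  where the recursion determines every term, including those before \<open>j\<close>.\<close>

lemma solves_ivp_ex1:
  assumes inv: "\<And>n. invertible (B n)"
  shows "\<exists>!z. solves_ivp B j \<xi> z"
proof (rule ex_ex1I)
  let ?z = "\<lambda>n. forward_prod B 0 n *v (matrix_inv (forward_prod B 0 j) *v \<xi>)"
  have "solves_ivp B j \<xi> ?z"
    using matrix_inv_cancel[OF invertible_forward_prod[of B, OF inv]]
    by (simp add: solves_ivp_def matrix_vector_mul_assoc[symmetric])
  then show "\<exists>z. solves_ivp B j \<xi> z" by blast
next
  fix y z assume "solves_ivp B j \<xi> y" "solves_ivp B j \<xi> z"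
  then have rec: "y (n + 1) = B n *v y n" "z (n + 1) = B n *v z n" and eq: "y j = z j" for n
    by (auto simp: solves_ivp_def)
  have y: "y n = forward_prod B 0 n *v y 0" and z: "z n = forward_prod B 0 n *v z 0" for n
    using forward_prod_solution[of 0 n y B, OF rec(1)] forward_prod_solution[of 0 n z B, OF rec(2)]
    by simp_all
  have "forward_prod B 0 j *v y 0 = forward_prod B 0 j *v z 0"
    using eq unfolding y[of j] z[of j] .
  then have "y 0 = z 0"
    by (rule injD[OF inj_matrix_vector_mult[OF invertible_forward_prod[of B, OF inv]]])
  then show "y = z" by (intro ext) (subst y, subst z, simp)
qed

section \<open>Changing one term of a Lyapunov sequence\<close>

lemma bounded_seq_update:
  assumes "bounded_seq B" "\<And>n. n \<noteq> i \<Longrightarrow> C n = B n"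
  shows "bounded_seq C"
proof -
  obtain K where "\<And>n. opnorm (B n) \<le> K" using assms(1) by (auto simp: bounded_seq_def)
  then have "opnorm (C n) \<le> max K (opnorm (C i))" for n
    using assms(2)[of n] by (cases "n = i") (auto simp: le_max_iff_disj)
  then show ?thesis by (auto simp: bounded_seq_def)
qed

text \<open>A change at the single index \<open>i\<close> alters only one term of the sequence of
  inverses as well, so both bounds survive with a larger constant.\<close>

lemma Lya_update:
  assumes "B \<in> Lya" "\<And>n. n \<noteq> i \<Longrightarrow> C n = B n" "invertible (C i)"
  shows "C \<in> Lya"
proof -
  have "invertible (C n)" for n
    using assms by (cases "n = i") (auto simp: Lya_def)
  moreover have "bounded_seq C"
    using assms by (auto simp: Lya_def intro: bounded_seq_update)
  moreover have "bounded_seq (\<lambda>n. matrix_inv (C n))"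
    by (rule bounded_seq_update[of "\<lambda>n. matrix_inv (B n)" i])
      (use assms in \<open>auto simp: Lya_def\<close>)
  ultimately show ?thesis by (simp add: Lya_def)
qed

theorem theorem38:
  fixes A :: "nat \<Rightarrow> real^'d^'d" and \<epsilon> :: real and k m :: nat
    and x0 :: "real^'d" and x :: "nat \<Rightarrow> real^'d"
  assumes "A \<in> Lya" and "\<epsilon> > 0" and "m > k" and "x0 \<noteq> 0"
    and "solves_ivp A 0 x0 x"
  shows
    "(k \<ge> 1 \<longrightarrow>
       (\<exists>Q :: nat \<Rightarrow> real^'d^'d.
          (\<forall>n. n \<noteq> k - 1 \<longrightarrow> Q n = 0) \<and>
          opnorm (Q (k - 1)) \<le> \<epsilon> * opnorm (A (k - 1)) \<and>
          (\<lambda>n. A n + Q n) \<in> Lya \<and>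
          (\<exists>!z. solves_ivp (\<lambda>n. A n + Q n) (k - 1) (x (k - 1)) z) \<and>
          (\<forall>z. solves_ivp (\<lambda>n. A n + Q n) (k - 1) (x (k - 1)) z \<longrightarrow>
             norm (z m) \<ge> sin \<epsilon> / 2 * opnorm (transition A m k) * norm (z k) \<and>
             norm (x k) = norm (z k))))
     \<and>
       (\<exists>Q :: nat \<Rightarrow> real^'d^'d.
          (\<forall>n. n \<noteq> m \<longrightarrow> Q n = 0) \<and>
          opnorm (Q m) \<le> \<epsilon> * opnorm (A m) \<and>
          (\<lambda>n. A n + Q n) \<in> Lya \<and>
          (\<exists>!z. solves_ivp (\<lambda>n. A n + Q n) (m + 1) (x (m + 1)) z) \<and>
          (\<forall>z. solves_ivp (\<lambda>n. A n + Q n) (m + 1) (x (m + 1)) z \<longrightarrow>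
             norm (z k) \<ge> sin \<epsilon> / 2 * opnorm (transition A k m) * norm (z m) \<and>
             norm (x m) = norm (z m)))"
proof -
  have inv: "invertible (A n)" for n using \<open>A \<in> Lya\<close> by (simp add: Lya_def)
  have x: "x (n + 1) = A n *v x n" "x 0 = x0" for n
    using \<open>solves_ivp A 0 x0 x\<close> by (auto simp: solves_ivp_def)
  have x_nz: "x n \<noteq> 0" for n
  proof
    assume "x n = 0"
    then have "forward_prod A 0 n *v x0 = 0"
      using forward_prod_solution[of 0 n x A] x by simp
    then show False
      using matrix_inv_cancel(1)[OF invertible_forward_prod[of A 0 n, OF inv], of x0] \<open>x0 \<noteq> 0\<close> by simp
  qed
  have unit: "norm (inverse (norm (x n)) *\<^sub>R x n) = 1"
    and dir: "norm (x n) *\<^sub>R (inverse (norm (x n)) *\<^sub>R x n) = x n" for n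
    using x_nz[of n] by simp_all
  show ?thesis
  proof (intro conjI impI)

    \<comment> \<open>Forward rotation at time \<open>k - 1\<close>\<close>
    assume "k \<ge> 1"
    define u where "u = inverse (norm (x k)) *\<^sub>R x k"
    have u: "norm u = 1" unfolding u_def by (rule unit)
    obtain w where w: "norm w = 1" "norm (w - u) \<le> \<epsilon>" "u \<bullet> w > 0"
      "sin \<epsilon> / 2 * opnorm (transition A m k) \<le> norm (transition A m k *v w)"
      using stretched_direction[OF u \<open>\<epsilon> > 0\<close>] by blast
    obtain S where S: "opnorm S \<le> norm (w - u)" "invertible (mat 1 + S)" "(mat 1 + S) *v u = w"
      using rank_one_update[OF u, of w] w(3) by auto
    \<comment> \<open>With \<open>S\<close> on the left, the update acts after
      \<open>A (k - 1)\<close>, hence on the direction of \<open>x k\<close>.\<close>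
    define Q where "Q = (\<lambda>n. if n = k - 1 then S ** A (k - 1) else 0)"
    have AQ: "A (k - 1) + Q (k - 1) = (mat 1 + S) ** A (k - 1)"
      by (simp add: Q_def matrix_eq matrix_vector_mult_add_rdistrib flip: matrix_vector_mul_assoc)
    have Lya: "(\<lambda>n. A n + Q n) \<in> Lya"
      by (rule Lya_update[OF \<open>A \<in> Lya\<close>, of "k - 1"])
        (simp add: Q_def, simp only: AQ S inv invertible_mult)
    show "\<exists>Q :: nat \<Rightarrow> real^'d^'d.
          (\<forall>n. n \<noteq> k - 1 \<longrightarrow> Q n = 0) \<and>
          opnorm (Q (k - 1)) \<le> \<epsilon> * opnorm (A (k - 1)) \<and>
          (\<lambda>n. A n + Q n) \<in> Lya \<and>
          (\<exists>!z. solves_ivp (\<lambda>n. A n + Q n) (k - 1) (x (k - 1)) z) \<and>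
          (\<forall>z. solves_ivp (\<lambda>n. A n + Q n) (k - 1) (x (k - 1)) z \<longrightarrow>
             norm (z m) \<ge> sin \<epsilon> / 2 * opnorm (transition A m k) * norm (z k) \<and>
             norm (x k) = norm (z k))"
    proof (intro exI[of _ Q] conjI)
      show "\<forall>n. n \<noteq> k - 1 \<longrightarrow> Q n = 0" by (simp add: Q_def)
      have "opnorm (Q (k - 1)) \<le> opnorm S * opnorm (A (k - 1))"
        by (simp add: Q_def opnorm_mult)
      also have "\<dots> \<le> \<epsilon> * opnorm (A (k - 1))"
        using S(1) w(2) by (intro mult_right_mono opnorm_nonneg) simp
      finally show "opnorm (Q (k - 1)) \<le> \<epsilon> * opnorm (A (k - 1))" .
      show "(\<lambda>n. A n + Q n) \<in> Lya" by (fact Lya)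
      show "\<exists>!z. solves_ivp (\<lambda>n. A n + Q n) (k - 1) (x (k - 1)) z"
        using Lya by (intro solves_ivp_ex1) (simp add: Lya_def)
      show "\<forall>z. solves_ivp (\<lambda>n. A n + Q n) (k - 1) (x (k - 1)) z \<longrightarrow>
             norm (z m) \<ge> sin \<epsilon> / 2 * opnorm (transition A m k) * norm (z k) \<and>
             norm (x k) = norm (z k)"
      proof (intro allI impI)
        fix z assume z: "solves_ivp (\<lambda>n. A n + Q n) (k - 1) (x (k - 1)) z"
        have "z k = (A (k - 1) + Q (k - 1)) *v x (k - 1)"
          using z \<open>k \<ge> 1\<close> unfolding solves_ivp_def by (metis le_add_diff_inverse2)
        also have "\<dots> = (mat 1 + S) *v x k"
          unfolding AQ using x(1)[of "k - 1"] \<open>k \<ge> 1\<close> by (simp add: matrix_vector_mul_assoc)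
        also have "\<dots> = norm (x k) *\<^sub>R w"
          using dir[of k] S(3) unfolding u_def[symmetric] by (metis matrix_vector_mult_scaleR)
        finally have zk: "z k = norm (x k) *\<^sub>R w" .
        \<comment> \<open>The perturbed index \<open>k - 1\<close> lies just before the window
          because \<open>k \<ge> 1\<close>, so the product involves \<open>A\<close> alone.\<close>
        have "z (k + (m - k)) = forward_prod A k (m - k) *v z k"
          using z \<open>k \<ge> 1\<close> by (intro forward_prod_solution) (auto simp: solves_ivp_def Q_def)
        then have "z m = transition A m k *v z k"
          using \<open>m > k\<close> by (simp add: transition_def)
        then have "norm (z m) = norm (x k) * norm (transition A m k *v w)"
          by (simp add: zk matrix_vector_mult_scaleR)
        moreover have "norm (x k) = norm (z k)" using w(1) by (simp add: zk)
        ultimately show "norm (z m) \<ge> sin \<epsilon> / 2 * opnorm (transition A m k) * norm (z k) \<and>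
             norm (x k) = norm (z k)"
          using mult_left_mono[OF w(4) norm_ge_zero[of "x k"]] by (simp add: mult.commute)
      qed
    qed
  next

    \<comment> \<open>Backward rotation at time \<open>m\<close>\<close>
    define u where "u = inverse (norm (x m)) *\<^sub>R x m"
    have u: "norm u = 1" unfolding u_def by (rule unit)
    obtain w where w: "norm w = 1" "norm (w - u) \<le> \<epsilon>" "u \<bullet> w > 0"
      "sin \<epsilon> / 2 * opnorm (transition A k m) \<le> norm (transition A k m *v w)"
      using stretched_direction[OF u \<open>\<epsilon> > 0\<close>] by blast
    \<comment> \<open>The roles are exchanged: the perturbed step must carry the direction
      \<open>w\<close> at time \<open>m\<close> to the same image that \<open>A m\<close> gives to
      \<open>u\<close>.\<close>
    obtain S where S: "opnorm S \<le> norm (u - w)" "invertible (mat 1 + S)" "(mat 1 + S) *v w = u"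
      using rank_one_update[of w u] w by (auto simp: inner_commute)
    define Q where "Q = (\<lambda>n. if n = m then A m ** S else 0)"
    have AQ: "A m + Q m = A m ** (mat 1 + S)"
      by (simp add: Q_def matrix_add_ldistrib)
    have Lya: "(\<lambda>n. A n + Q n) \<in> Lya"
      by (rule Lya_update[OF \<open>A \<in> Lya\<close>, of m])
        (simp add: Q_def, simp only: AQ S inv invertible_mult)
    show "\<exists>Q :: nat \<Rightarrow> real^'d^'d.
          (\<forall>n. n \<noteq> m \<longrightarrow> Q n = 0) \<and>
          opnorm (Q m) \<le> \<epsilon> * opnorm (A m) \<and>
          (\<lambda>n. A n + Q n) \<in> Lya \<and>
          (\<exists>!z. solves_ivp (\<lambda>n. A n + Q n) (m + 1) (x (m + 1)) z) \<and>
          (\<forall>z. solves_ivp (\<lambda>n. A n + Q n) (m + 1) (x (m + 1)) z \<longrightarrow>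
             norm (z k) \<ge> sin \<epsilon> / 2 * opnorm (transition A k m) * norm (z m) \<and>
             norm (x m) = norm (z m))"
    proof (intro exI[of _ Q] conjI)
      show "\<forall>n. n \<noteq> m \<longrightarrow> Q n = 0" by (simp add: Q_def)
      have "opnorm (Q m) \<le> opnorm (A m) * opnorm S"
        by (simp add: Q_def opnorm_mult)
      also have "\<dots> \<le> opnorm (A m) * \<epsilon>"
        using S(1) w(2) by (intro mult_left_mono opnorm_nonneg) (simp add: norm_minus_commute)
      finally show "opnorm (Q m) \<le> \<epsilon> * opnorm (A m)" by (simp add: mult.commute)
      show "(\<lambda>n. A n + Q n) \<in> Lya" by (fact Lya)
      show "\<exists>!z. solves_ivp (\<lambda>n. A n + Q n) (m + 1) (x (m + 1)) z"
        using Lya by (intro solves_ivp_ex1) (simp add: Lya_def)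
      show "\<forall>z. solves_ivp (\<lambda>n. A n + Q n) (m + 1) (x (m + 1)) z \<longrightarrow>
             norm (z k) \<ge> sin \<epsilon> / 2 * opnorm (transition A k m) * norm (z m) \<and>
             norm (x m) = norm (z m)"
      proof (intro allI impI)
        fix z assume z: "solves_ivp (\<lambda>n. A n + Q n) (m + 1) (x (m + 1)) z"
        have "(A m + Q m) *v z m = A m *v x m"
          using z x(1)[of m] unfolding solves_ivp_def by metis
        also have "\<dots> = A m *v ((mat 1 + S) *v (norm (x m) *\<^sub>R w))"
          using dir[of m] S(3) unfolding u_def[symmetric] by (metis matrix_vector_mult_scaleR)
        also have "\<dots> = (A m + Q m) *v (norm (x m) *\<^sub>R w)"
          unfolding AQ by (simp add: matrix_vector_mul_assoc)
        \<comment> \<open>The prescribed value at \<open>m + 1\<close> fixes \<open>z m\<close>,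
          since the perturbed matrix \<open>A m + Q m\<close> can be cancelled.\<close>
        finally have zm: "z m = norm (x m) *\<^sub>R w"
          using Lya by (metis (no_types, lifting) Lya_def matrix_inv_cancel(1) mem_Collect_eq)
        \<comment> \<open>The window ends at \<open>m - 1\<close>, before the perturbed index.
          Inverting this unperturbed product gives the backward transition from \<open>m\<close> to
          \<open>k\<close>.\<close>
        have "z (k + (m - k)) = forward_prod A k (m - k) *v z k"
          using z by (intro forward_prod_solution) (auto simp: solves_ivp_def Q_def)
        then have "z k = transition A k m *v z m"
          using \<open>m > k\<close> matrix_inv_cancel(1)[OF invertible_forward_prod[of A, OF inv]]
          by (simp add: transition_def)
        then have "norm (z k) = norm (x m) * norm (transition A k m *v w)"
          by (simp add: zm matrix_vector_mult_scaleR)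
        moreover have "norm (x m) = norm (z m)" using w(1) by (simp add: zm)
        ultimately show "norm (z k) \<ge> sin \<epsilon> / 2 * opnorm (transition A k m) * norm (z m) \<and>
             norm (x m) = norm (z m)"
          using mult_left_mono[OF w(4) norm_ge_zero[of "x m"]] by (simp add: mult.commute)
      qed
    qed
  qed
qed

end
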